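(* For each integer $m\ge3$ there is a noncommutative graph $T\subseteq\mathcal{L}(\mathbb{C}^{m+1})$ with $\mathcal{C}_0^{(1)}(T)=0$ such that $$\mathcal{C}_0^{(1)}(\mathbb{C}I_2\otimes T)\ge\log_2 m>1=\mathcal{C}_0^{(1)}(\mathbb{C}I_2)+\mathcal{C}_0^{(1)}(T).$$
   Context: $\mathcal{L}(\mathbb{C}^n)$ is the space of linear operators ($n\times n$ complex matrices) on $\mathbb{C}^n$, with Hilbert–Schmidt inner product $\langle X,Y\rangle=\mathrm{Tr}(X^\dagger Y)$; $\perp$ refers to this inner product. A noncommutative graph is a complex linear subspace $S\subseteq\mathcal{L}(\mathbb{C}^n)$ with $S=S^\dagger$ (closed under conjugate transpose) and $I\in S$. For a noncommutative graph $S\subseteq\mathcal{L}(\mathbb{C}^n)$, let $\alpha(S)$ be the maximum number $k$ of nonzero vectors $|\psi_1\rangle,\dots,|\psi_k\rangle\in\mathbb{C}^n$ such that $|\psi_s\rangle\langle\psi_t|\perp S$ for all $s\ne t$. The one-shot zero-error classical capacity is $\mathcal{C}_0^{(1)}(S)=\log_2\alpha(S)$. $S\otimes T$ denotes the span of all $P\otimes Q$ with $P\in S$, $Q\in T$. $I_2$ is the $2\times2$ identity matrix. *)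

theory Defs
  imports
    "Jordan_Normal_Form.VS_Connect"
    "Jordan_Normal_Form.Schur_Decomposition"
begin

text \<open>
  \<open>\<L>(\<complex>\<^sup>n)\<close> is \<^term>\<open>carrier_mat n n :: complex mat set\<close>, viewed as a complex vector space
  through \<^const>\<open>module_mat\<close>; the adjoint is \<^const>\<open>mat_adjoint\<close>.
\<close>

abbreviation op_space :: "nat \<Rightarrow> (complex, complex mat) module" where
  "op_space n \<equiv> module_mat TYPE(complex) n n"

lemma vectorspace_op_space: "vectorspace class_ring (op_space n)"
proof -
  interpret abelian_group "op_space n" by (rule abelian_group_mat)
  show ?thesis
    by unfold_locales
      (auto simp: module_mat_simps add_smult_distrib_left_mat add_smult_distrib_right_mat)
qed

definition mat_trace :: "complex mat \<Rightarrow> complex" where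
  "mat_trace A = (\<Sum>i<dim_row A. A $$ (i, i))"

definition hs_inner :: "complex mat \<Rightarrow> complex mat \<Rightarrow> complex" where
  "hs_inner X Y = mat_trace (mat_adjoint X * Y)"

definition hs_orthogonal :: "complex mat \<Rightarrow> complex mat set \<Rightarrow> bool" where
  "hs_orthogonal X S \<longleftrightarrow> (\<forall>Y\<in>S. hs_inner X Y = 0)"

definition ket_bra :: "complex vec \<Rightarrow> complex vec \<Rightarrow> complex mat" where
  "ket_bra v w = mat (dim_vec v) (dim_vec w) (\<lambda>(i, j). v $ i * cnj (w $ j))"

definition noncommutative_graph :: "nat \<Rightarrow> complex mat set \<Rightarrow> bool" where
  "noncommutative_graph n S \<longleftrightarrow>
     VectorSpace.subspace class_ring S (op_space n) \<and> mat_adjoint ` S = S \<and> 1\<^sub>m n \<in> S"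

text \<open>
  The \<^const>\<open>Max\<close> below is taken over a finite set containing 0 whenever \<open>S\<close> is a noncommutative
  graph: since \<open>I \<in> S\<close>, admissible vectors are pairwise orthogonal (in particular distinct), so
  \<open>k \<le> n\<close>.
\<close>

definition independence_number :: "nat \<Rightarrow> complex mat set \<Rightarrow> nat" where
  "independence_number n S = Max {k. \<exists>\<psi> :: nat \<Rightarrow> complex vec.
     (\<forall>s<k. \<psi> s \<in> carrier_vec n \<and> \<psi> s \<noteq> 0\<^sub>v n) \<and>
     (\<forall>s<k. \<forall>t<k. s \<noteq> t \<longrightarrow> hs_orthogonal (ket_bra (\<psi> s) (\<psi> t)) S)}"

definition zero_error_capacity :: "nat \<Rightarrow> complex mat set \<Rightarrow> real" where
  "zero_error_capacity n S = log 2 (real (independence_number n S))"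

text \<open>Kronecker product, identifying \<open>e\<^sub>i \<otimes> e\<^sub>j\<close> with the basis vector of index \<open>i * dim B + j\<close>.\<close>

definition kronecker :: "complex mat \<Rightarrow> complex mat \<Rightarrow> complex mat" where
  "kronecker A B = mat (dim_row A * dim_row B) (dim_col A * dim_col B)
     (\<lambda>(i, j). A $$ (i div dim_row B, j div dim_col B) * B $$ (i mod dim_row B, j mod dim_col B))"

definition graph_tensor ::
  "nat \<Rightarrow> nat \<Rightarrow> complex mat set \<Rightarrow> complex mat set \<Rightarrow> complex mat set" where
  "graph_tensor n p S T =
     LinearCombinations.module.span class_ring (op_space (n * p)) {kronecker P Q | P Q. P \<in> S \<and> Q \<in> T}"

definition scalar_graph :: "nat \<Rightarrow> complex mat set" where
  "scalar_graph n = {c \<cdot>\<^sub>m 1\<^sub>m n | c. True}"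

end

theory Submission
  imports Defs
begin

text \<open>
  Let \<open>T\<close> consist of the matrices whose off-diagonal entries alternate in sign along each
  diagonal: \<open>Y (i + 1, j + 1) = - Y (i, j)\<close> for \<open>i \<noteq> j\<close>. The vectors
  \<open>\<psi>\<^sub>s = e\<^sub>0 \<otimes> e\<^sub>s + e\<^sub>1 \<otimes> e\<^sub>s\<^sub>+\<^sub>1\<close> for \<open>s < m\<close> satisfy
  \<open>\<langle>\<psi>\<^sub>s, (I \<otimes> Y) \<psi>\<^sub>t\<rangle> = Y (s, t) + Y (s + 1, t + 1) = 0\<close>, so \<open>\<alpha>(\<complex>I\<^sub>2 \<otimes> T) \<ge> m\<close>.
  On the other hand \<open>T\<close> has no two independent vectors \<open>u\<close>, \<open>v\<close>: let \<open>i\<close> be the last index in the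
  support of \<open>u\<close> and \<open>j\<close> the first index in the support of \<open>v\<close>. The element of \<open>T\<close> with entries
  \<open>\<plusminus>1\<close> along the diagonal through \<open>(i, j)\<close> pairs \<open>u\<close> and \<open>v\<close> to the single nonzero term
  \<open>\<plusminus> cnj (u\<^sub>i) v\<^sub>j\<close>.
\<close>

section \<open>Independent vectors of a graph\<close>

lemma adjoint_dims [simp]:
  "dim_row (mat_adjoint A) = dim_col A" "dim_col (mat_adjoint A) = dim_row A"
  by (auto simp: mat_adjoint_def)

lemma adjoint_index [simp]:
  "i < dim_col A \<Longrightarrow> j < dim_row A \<Longrightarrow> mat_adjoint A $$ (i, j) = cnj (A $$ (j, i))"
  by (simp add: mat_adjoint_def mat_of_rows_index)

text \<open>The pairing is Tr(|w><v| Y) = <v, Y w>, so orthogonality to a graph becomes the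
  vanishing of a double sum over matrix entries.\<close>

lemma hs_inner_ket_bra:
  assumes "v \<in> carrier_vec n" "w \<in> carrier_vec n" "Y \<in> carrier_mat n n"
  shows "hs_inner (ket_bra v w) Y = (\<Sum>i<n. \<Sum>j<n. cnj (v $ i) * w $ j * Y $$ (i, j))"
proof -
  have "hs_inner (ket_bra v w) Y = (\<Sum>j<n. \<Sum>i<n. cnj (v $ i) * w $ j * Y $$ (i, j))"
    using assms
    by (auto simp: hs_inner_def mat_trace_def ket_bra_def scalar_prod_def lessThan_atLeast0
        intro!: sum.cong)
  also have "\<dots> = (\<Sum>i<n. \<Sum>j<n. cnj (v $ i) * w $ j * Y $$ (i, j))"
    by (rule sum.swap)
  finally show ?thesis .
qed

definition independent_vecs :: "nat \<Rightarrow> complex mat set \<Rightarrow> nat \<Rightarrow> (nat \<Rightarrow> complex vec) \<Rightarrow> bool" where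
  "independent_vecs n S k \<psi> \<longleftrightarrow>
     (\<forall>s<k. \<psi> s \<in> carrier_vec n \<and> \<psi> s \<noteq> 0\<^sub>v n) \<and>
     (\<forall>s<k. \<forall>t<k. s \<noteq> t \<longrightarrow> hs_orthogonal (ket_bra (\<psi> s) (\<psi> t)) S)"

lemma independence_number_altdef:
  "independence_number n S = Max {k. \<exists>\<psi>. independent_vecs n S k \<psi>}"
  by (simp add: independence_number_def independent_vecs_def)

lemma independent_vecs_orthogonal:
  assumes "independent_vecs n S k \<psi>" "Y \<in> S" "Y \<in> carrier_mat n n" "s < k" "t < k" "s \<noteq> t"
  shows "(\<Sum>i<n. \<Sum>j<n. cnj (\<psi> s $ i) * \<psi> t $ j * Y $$ (i, j)) = 0"
  using assms hs_inner_ket_bra[of "\<psi> s" n "\<psi> t" Y]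
  by (auto simp: independent_vecs_def hs_orthogonal_def)

text \<open>Applied to the identity operator, this reduces orthogonality in the graph to ordinary
  orthogonality of vectors.\<close>

lemma sum_one_mat:
  "(\<Sum>i<n. \<Sum>j<n. a i * b j * 1\<^sub>m n $$ (i, j)) = (\<Sum>i<n. a i * b i :: complex)"
proof (rule sum.cong[OF refl])
  fix i assume i: "i \<in> {..<n}"
  have "(\<Sum>j<n. a i * b j * 1\<^sub>m n $$ (i, j)) = (\<Sum>j<n. if j = i then a i * b i else 0)"
    using i by (intro sum.cong) auto
  then show "(\<Sum>j<n. a i * b j * 1\<^sub>m n $$ (i, j)) = a i * b i"
    using i by simp
qed

text \<open>
  For \<open>k > n\<close> the vectors, padded with zeros to length \<open>k\<close>, form a square matrix with a zero row;
  its Gram matrix is diagonal without zeros on the diagonal.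
\<close>

lemma independent_vecs_le:
  assumes ind: "independent_vecs n S k \<psi>" and one: "1\<^sub>m n \<in> S"
  shows "k \<le> n"
proof (rule ccontr)
  assume "\<not> k \<le> n"
  then have k: "n < k" by simp
  define A where "A = mat k k (\<lambda>(i, s). if i < n then \<psi> s $ i else 0)"
  define B where "B = mat k k (\<lambda>(s, i). if i < n then cnj (\<psi> s $ i) else 0)"
  have A: "A \<in> carrier_mat k k" and B: "B \<in> carrier_mat k k"
    by (auto simp: A_def B_def)
  have gram: "(B * A) $$ (s, t) = (\<Sum>i<n. cnj (\<psi> s $ i) * \<psi> t $ i)" if "s < k" "t < k" for s t
  proof -
    have "(B * A) $$ (s, t) = (\<Sum>i<k. if i < n then cnj (\<psi> s $ i) * \<psi> t $ i else 0)"
      using that by (auto simp: A_def B_def scalar_prod_def lessThan_atLeast0 intro!: sum.cong)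
    also have "\<dots> = (\<Sum>i<n. cnj (\<psi> s $ i) * \<psi> t $ i)"
      using k by (intro sum.mono_neutral_cong_right) auto
    finally show ?thesis .
  qed
  have off: "(B * A) $$ (s, t) = 0" if "s < k" "t < k" "s \<noteq> t" for s t
    using independent_vecs_orthogonal[OF ind one _ that] gram[OF that(1,2)]
    by (simp only: sum_one_mat one_carrier_mat)
  have diag: "(B * A) $$ (s, s) \<noteq> 0" if "s < k" for s
  proof
    assume "(B * A) $$ (s, s) = 0"
    then have "(\<Sum>i<n. complex_of_real ((cmod (\<psi> s $ i))\<^sup>2)) = 0"
      using gram[OF that that] by (simp only: complex_norm_square mult.commute)
    then have "(\<Sum>i<n. (cmod (\<psi> s $ i))\<^sup>2) = 0"
      by (metis of_real_eq_0_iff of_real_sum)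
    then have "\<forall>i<n. \<psi> s $ i = 0"
      by (simp add: sum_nonneg_eq_0_iff)
    then have "\<psi> s = 0\<^sub>v n"
      using ind that by (intro eq_vecI) (auto simp: independent_vecs_def)
    then show False
      using ind that by (simp add: independent_vecs_def)
  qed
  have "det (B * A) \<noteq> 0"
  proof -
    have "upper_triangular (B * A)"
      using off A B by (auto simp: upper_triangular_def)
    moreover have "B * A \<in> carrier_mat k k"
      using A B by simp
    moreover have "0 \<notin> set (diag_mat (B * A))"
      using diag A B by (auto simp: diag_mat_def simp del: index_mult_mat(1))
    ultimately show ?thesis
      using upper_triangular_imp_det_eq_0_iff by blast
  qed
  moreover have "det A = 0"
  proof -
    \<comment> \<open>Row \<open>n\<close> exists because \<open>n < k\<close> and consists of
      padding zeros. Scaling it by 0 changes nothing, so \<open>det A = 0 * det A\<close>.\<close>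
    have "A = multrow n 0 A"
      using k by (intro eq_matI) (auto simp: A_def)
    then show ?thesis
      using det_multrow[OF k A, of 0] by simp
  qed
  ultimately show False
    using det_mult[OF B A] by simp
qed

text \<open>\<open>Max\<close> is informative only on a finite set; membership of the identity
  supplies the bound \<open>n\<close>.\<close>

lemma finite_independent_vecs:
  assumes "1\<^sub>m n \<in> S"
  shows "finite {k. \<exists>\<psi>. independent_vecs n S k \<psi>}"
  using independent_vecs_le[OF _ assms] by (auto intro!: finite_subset[of _ "{..n}"])

lemma independence_number_ge:
  assumes "1\<^sub>m n \<in> S" "independent_vecs n S k \<psi>"
  shows "k \<le> independence_number n S"
  unfolding independence_number_altdef
  using assms finite_independent_vecs by (intro Max_ge) auto

lemma independence_number_eqI:
  assumes "1\<^sub>m n \<in> S" "independent_vecs n S k \<psi>"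
    and "\<And>l \<phi>. independent_vecs n S l \<phi> \<Longrightarrow> l \<le> k"
  shows "independence_number n S = k"
  unfolding independence_number_altdef
  using assms finite_independent_vecs by (intro Max_eqI) auto

text \<open>Orthogonality to the scalars is orthogonality of the vectors, so the standard basis
  attains the bound of \<open>independent_vecs_le\<close>.\<close>

lemma independence_number_scalar_graph: "independence_number n (scalar_graph n) = n"
proof (rule independence_number_eqI)
  show one: "1\<^sub>m n \<in> scalar_graph n"
    by (auto simp: scalar_graph_def intro!: exI[of _ 1])
  show "l \<le> n" if "independent_vecs n (scalar_graph n) l \<phi>" for l \<phi>
    using independent_vecs_le[OF that one] .
  have "hs_orthogonal (ket_bra (unit_vec n s) (unit_vec n t)) (scalar_graph n)"
    if "s < n" "t < n" "s \<noteq> t" for s t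
    using that
    by (auto simp: hs_orthogonal_def scalar_graph_def hs_inner_ket_bra[of _ n] intro!: sum.neutral)
  moreover have "unit_vec n s \<noteq> (0\<^sub>v n :: complex vec)" if "s < n" for s
    using that by simp
  ultimately show "independent_vecs n (scalar_graph n) n (unit_vec n)"
    by (auto simp: independent_vecs_def)
qed

section \<open>Subspaces of operators and orthogonality to a span\<close>

lemma subspace_op_spaceI:
  assumes "S \<subseteq> carrier_mat n n" "0\<^sub>m n n \<in> S"
    and "\<And>A B. A \<in> S \<Longrightarrow> B \<in> S \<Longrightarrow> A + B \<in> S" "\<And>c A. A \<in> S \<Longrightarrow> c \<cdot>\<^sub>m A \<in> S"
  shows "VectorSpace.subspace class_ring S (op_space n)"
proof -
  interpret V: vectorspace class_ring "op_space n" by (rule vectorspace_op_space)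
  show ?thesis
    unfolding VectorSpace.subspace_def
    using assms V.vectorspace_axioms V.module_axioms
    by (auto simp: submodule_def module_mat_simps)
qed

text \<open>The operators orthogonal to a fixed one form a subspace, which contains the span once it
  contains the generators. Hence for \<open>graph_tensor\<close> only Kronecker products need
  checking.\<close>

lemma hs_orthogonal_span:
  assumes v: "v \<in> carrier_vec n" and w: "w \<in> carrier_vec n" and S: "S \<subseteq> carrier_mat n n"
    and orth: "hs_orthogonal (ket_bra v w) S"
  shows "hs_orthogonal (ket_bra v w) (LinearCombinations.module.span class_ring (op_space n) S)"
proof -
  interpret V: vectorspace class_ring "op_space n" by (rule vectorspace_op_space)
  define N where "N = {Y \<in> carrier_mat n n. hs_inner (ket_bra v w) Y = 0}"
  have "VectorSpace.subspace class_ring N (op_space n)"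
  proof (rule subspace_op_spaceI)
    show "A + B \<in> N" if "A \<in> N" "B \<in> N" for A B
    proof -
      have "A \<in> carrier_mat n n" "B \<in> carrier_mat n n"
        using that by (simp_all add: N_def)
      then have "hs_inner (ket_bra v w) (A + B) = hs_inner (ket_bra v w) A + hs_inner (ket_bra v w) B"
        by (simp add: hs_inner_ket_bra[OF v w] distrib_left sum.distrib)
      then show ?thesis
        using that by (simp add: N_def)
    qed
    show "c \<cdot>\<^sub>m A \<in> N" if "A \<in> N" for c A
    proof -
      have "A \<in> carrier_mat n n"
        using that by (simp add: N_def)
      then have "hs_inner (ket_bra v w) (c \<cdot>\<^sub>m A) = c * hs_inner (ket_bra v w) A"
        by (simp add: hs_inner_ket_bra[OF v w] sum_distrib_left mult_ac)
      then show ?thesis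
        using that by (simp add: N_def)
    qed
  qed (auto simp: N_def hs_inner_ket_bra[OF v w])
  moreover have "S \<subseteq> N"
    using S orth by (auto simp: N_def hs_orthogonal_def)
  ultimately have "V.span S \<subseteq> N"
    by (intro V.span_is_subset) (auto simp: VectorSpace.subspace_def)
  then show ?thesis
    by (auto simp: N_def hs_orthogonal_def)
qed

section \<open>Tensoring with the scalar graph\<close>

text \<open>The product is block diagonal with \<open>k\<close> copies of \<open>c\<close> times
  \<open>Y\<close>: \<open>i div p\<close> is the block and \<open>i mod p\<close> the position
  inside it.\<close>

lemma kronecker_scalar_index:
  assumes "Y \<in> carrier_mat p p" "i < k * p" "j < k * p"
  shows "kronecker (c \<cdot>\<^sub>m 1\<^sub>m k) Y $$ (i, j) =
    (if i div p = j div p then c * Y $$ (i mod p, j mod p) else 0)"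
proof -
  have "i div p < k" "j div p < k"
    using assms(2,3) by (simp_all add: less_mult_imp_div_less)
  then show ?thesis
    using assms by (auto simp: kronecker_def)
qed

lemma kronecker_scalar_carrier:
  assumes "T \<subseteq> carrier_mat p p"
  shows "{kronecker P Q | P Q. P \<in> scalar_graph k \<and> Q \<in> T} \<subseteq> carrier_mat (k * p) (k * p)"
  using assms by (force simp: kronecker_def scalar_graph_def)

text \<open>I \<otimes> I = I is one of the generators. This makes
  \<open>independence_number_ge\<close> applicable to the tensor product.\<close>

lemma one_mem_graph_tensor_scalar:
  assumes T: "T \<subseteq> carrier_mat p p" and one: "1\<^sub>m p \<in> T"
  shows "1\<^sub>m (k * p) \<in> graph_tensor k p (scalar_graph k) T"
proof -
  interpret V: vectorspace class_ring "op_space (k * p)" by (rule vectorspace_op_space)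
  let ?G = "{kronecker P Q | P Q. P \<in> scalar_graph k \<and> Q \<in> T}"
  have "?G \<subseteq> carrier (op_space (k * p))"
    using kronecker_scalar_carrier[OF T] by (simp only: module_mat_simps)
  then have "?G \<subseteq> V.span ?G"
    by (rule V.in_own_span)
  moreover have "kronecker (1 \<cdot>\<^sub>m 1\<^sub>m k) (1\<^sub>m p) = 1\<^sub>m (k * p)" (is "?K = _")
  proof (rule eq_matI)
    fix i j assume "i < dim_row (1\<^sub>m (k * p) :: complex mat)" "j < dim_col (1\<^sub>m (k * p) :: complex mat)"
    then have ij: "i < k * p" "j < k * p" by auto
    then have "0 < p" by (cases p) auto
    have "i div p = j div p \<and> i mod p = j mod p \<longleftrightarrow> i = j"
      by (metis div_mult_mod_eq)
    then show "?K $$ (i, j) = 1\<^sub>m (k * p) $$ (i, j)"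
      using ij \<open>0 < p\<close> by (auto simp: kronecker_scalar_index[of _ p])
  qed (auto simp: kronecker_def)
  moreover have "?K \<in> ?G"
    using one by (auto simp: scalar_graph_def)
  ultimately show ?thesis
    unfolding graph_tensor_def by auto
qed

section \<open>Matrices with alternating diagonals\<close>

text \<open>The main diagonal is left free so that the identity belongs to the set. The condition is
  symmetric in \<open>i\<close> and \<open>j\<close>, which gives closure under the adjoint.\<close>

definition alternating_graph :: "nat \<Rightarrow> complex mat set" where
  "alternating_graph m = {Y \<in> carrier_mat (m + 1) (m + 1).
     \<forall>i<m. \<forall>j<m. i \<noteq> j \<longrightarrow> Y $$ (i + 1, j + 1) = - Y $$ (i, j)}"

lemma alternating_graph_carrier: "alternating_graph m \<subseteq> carrier_mat (m + 1) (m + 1)"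
  by (auto simp: alternating_graph_def)

lemma noncommutative_graph_alternating: "noncommutative_graph (m + 1) (alternating_graph m)"
proof -
  have adj: "mat_adjoint Y \<in> alternating_graph m" if "Y \<in> alternating_graph m" for Y
    using that by (auto simp: alternating_graph_def)
  \<comment> \<open>Involutivity upgrades invariance under the adjoint to equality of the image with
    the set.\<close>
  have "mat_adjoint (mat_adjoint Y) = Y" for Y :: "complex mat"
    by (intro eq_matI) auto
  then have "mat_adjoint ` alternating_graph m = alternating_graph m"
    using adj by (metis image_subsetI image_eqI subsetI subset_antisym)
  moreover have "VectorSpace.subspace class_ring (alternating_graph m) (op_space (m + 1))"
    by (rule subspace_op_spaceI) (auto simp: alternating_graph_def)
  moreover have "1\<^sub>m (m + 1) \<in> alternating_graph m"
    by (auto simp: alternating_graph_def)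
  ultimately show ?thesis
    by (simp add: noncommutative_graph_def)
qed

lemma alternating_graph_pairing_nonzero:
  assumes u: "u \<in> carrier_vec (m + 1)" "u \<noteq> 0\<^sub>v (m + 1)"
    and v: "v \<in> carrier_vec (m + 1)" "v \<noteq> 0\<^sub>v (m + 1)"
  shows "\<exists>Y\<in>alternating_graph m.
    (\<Sum>a<m + 1. \<Sum>b<m + 1. cnj (u $ a) * v $ b * Y $$ (a, b)) \<noteq> 0"
proof -
  let ?U = "{a. a < m + 1 \<and> u $ a \<noteq> 0}" and ?V = "{b. b < m + 1 \<and> v $ b \<noteq> 0}"
  define i where "i = Max ?U"
  define j where "j = Min ?V"
  have U: "finite ?U" "?U \<noteq> {}" and V: "finite ?V" "?V \<noteq> {}"
    using u v by (auto simp: vec_eq_iff)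
  have i: "i < m + 1" "u $ i \<noteq> 0" and j: "j < m + 1" "v $ j \<noteq> 0"
    using Max_in[OF U] Min_in[OF V] by (auto simp: i_def j_def)
  have imax: "a \<le> i" if "a < m + 1" "u $ a \<noteq> 0" for a
    using that U by (auto simp: i_def)
  have jmin: "j \<le> b" if "b < m + 1" "v $ b \<noteq> 0" for b
    using that V by (auto simp: j_def)
  \<comment> \<open>The condition \<open>a + j = b + i\<close> describes the diagonal through
    \<open>(i, j)\<close> without truncated subtraction; the sign depends on the row, hence
    alternates. If \<open>i = j\<close>, this is the unconstrained main diagonal.\<close>
  define Y where
    "Y = mat (m + 1) (m + 1) (\<lambda>(a, b). if a + j = b + i then (-1) ^ a else (0 :: complex))"
  have Y: "Y \<in> alternating_graph m"
    by (auto simp: alternating_graph_def Y_def)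
  have zero: "cnj (u $ a) * v $ b * Y $$ (a, b) = 0"
    if "a < m + 1" "b < m + 1" "(a, b) \<noteq> (i, j)" for a b
  proof (rule ccontr)
    assume nz: "cnj (u $ a) * v $ b * Y $$ (a, b) \<noteq> 0"
    then have "a \<le> i" "j \<le> b" "a + j = b + i"
      using that imax[of a] jmin[of b] by (auto simp: Y_def split: if_splits)
    \<comment> \<open>Adding the two inequalities gives \<open>a + j \<le> b + i\<close>; equality
      there forces \<open>a = i\<close> and \<open>b = j\<close>.\<close>
    then show False
      using that(3) by simp
  qed
  have "(\<Sum>a<m + 1. \<Sum>b<m + 1. cnj (u $ a) * v $ b * Y $$ (a, b)) =
      (\<Sum>(a, b)\<in>{..<m + 1} \<times> {..<m + 1}. cnj (u $ a) * v $ b * Y $$ (a, b))"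
    by (rule sum.cartesian_product)
  also have "\<dots> = (\<Sum>(a, b)\<in>{(i, j)}. cnj (u $ a) * v $ b * Y $$ (a, b))"
    using i j by (intro sum.mono_neutral_right) (auto simp del: mult_eq_0_iff intro!: zero)
  also have "\<dots> = cnj (u $ i) * v $ j * (-1) ^ i"
    using i j by (simp add: Y_def)
  finally show ?thesis
    using i j Y by (intro bexI[of _ Y]) auto
qed

section \<open>Independence numbers of the graph and of its tensor product\<close>

lemma independence_number_alternating: "independence_number (m + 1) (alternating_graph m) = 1"
proof (rule independence_number_eqI)
  show "1\<^sub>m (m + 1) \<in> alternating_graph m"
    using noncommutative_graph_alternating by (simp add: noncommutative_graph_def)
  \<comment> \<open>A single vector, here \<open>unit_vec (m + 1) 0\<close>, faces no orthogonality
    condition.\<close>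
  show "independent_vecs (m + 1) (alternating_graph m) 1 (unit_vec (m + 1))"
    by (auto simp: independent_vecs_def)
  show "l \<le> 1" if ind: "independent_vecs (m + 1) (alternating_graph m) l \<phi>" for l \<phi>
  proof (rule ccontr)
    assume "\<not> l \<le> 1"
    then have l: "0 < l" "1 < l" by auto
    then obtain Y where "Y \<in> alternating_graph m"
      "(\<Sum>a<m + 1. \<Sum>b<m + 1. cnj (\<phi> 0 $ a) * \<phi> 1 $ b * Y $$ (a, b)) \<noteq> 0"
      using ind alternating_graph_pairing_nonzero[of "\<phi> 0" m "\<phi> 1"]
      by (auto simp: independent_vecs_def)
    then show False
      using independent_vecs_orthogonal[OF ind _ _ l] alternating_graph_carrier by auto
  qed
qed

lemma independence_number_tensor_alternating:
  "m \<le> independence_number (2 * (m + 1)) (graph_tensor 2 (m + 1) (scalar_graph 2) (alternating_graph m))"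
proof (rule independence_number_ge)
  let ?p = "m + 1"
  let ?n = "2 * ?p"
  let ?T = "alternating_graph m"
  let ?G = "{kronecker P Q | P Q. P \<in> scalar_graph 2 \<and> Q \<in> ?T}"
  show "1\<^sub>m ?n \<in> graph_tensor 2 ?p (scalar_graph 2) ?T"
    using noncommutative_graph_alternating alternating_graph_carrier
    by (intro one_mem_graph_tensor_scalar) (auto simp: noncommutative_graph_def)
  \<comment> \<open>In the Kronecker ordering, the basis vector of block 1 at position
    \<open>s + 1\<close> has index \<open>?p + s + 1\<close>; \<open>s < m\<close> keeps it within
    the block.\<close>
  define \<psi> :: "nat \<Rightarrow> complex vec"
    where "\<psi> s = unit_vec ?n s + unit_vec ?n (?p + s + 1)" for s
  have carrier: "\<psi> s \<in> carrier_vec ?n" for s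
    by (simp add: \<psi>_def)
  have index: "\<psi> s $ i = (if i = s then 1 else 0) + (if i = ?p + s + 1 then 1 else (0 :: complex))"
    if "s < m" "i < ?n" for s i
    using that by (simp add: \<psi>_def)
  have nonzero: "\<psi> s \<noteq> 0\<^sub>v ?n" if "s < m" for s
    using index[OF that, of s] that by auto
  have G: "?G \<subseteq> carrier_mat ?n ?n"
    by (rule kronecker_scalar_carrier[OF alternating_graph_carrier])
  have "hs_orthogonal (ket_bra (\<psi> s) (\<psi> t)) ?G" if st: "s < m" "t < m" "s \<noteq> t" for s t
    unfolding hs_orthogonal_def
  proof
    fix Z assume "Z \<in> ?G"
    then obtain c Y where Z: "Z = kronecker (c \<cdot>\<^sub>m 1\<^sub>m 2) Y" and Y: "Y \<in> ?T"
      by (auto simp: scalar_graph_def)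
    have Yc: "Y \<in> carrier_mat ?p ?p"
      using Y alternating_graph_carrier by blast
    have row: "(\<Sum>j<?n. f j * \<psi> t $ j) = f t + f (?p + t + 1)" if "t < m"
      for f :: "nat \<Rightarrow> complex" and t
    proof -
      have "(\<Sum>j<?n. f j * \<psi> t $ j) =
          (\<Sum>j<?n. (if j = t then f t else 0) + (if j = ?p + t + 1 then f (?p + t + 1) else 0))"
        using that by (intro sum.cong) (auto simp: index)
      then show ?thesis
        using that by (simp add: sum.distrib)
    qed
    \<comment> \<open>The entries of these vectors are 0 or 1, so conjugation does not affect
      them.\<close>
    have col: "(\<Sum>j<?n. f j * cnj (\<psi> t $ j)) = f t + f (?p + t + 1)" if "t < m" for f t
    proof -
      have "(\<Sum>j<?n. f j * cnj (\<psi> t $ j)) = (\<Sum>j<?n. f j * \<psi> t $ j)"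
        using that by (intro sum.cong) (auto simp: index)
      then show ?thesis
        using row[OF that] by simp
    qed
    have "hs_inner (ket_bra (\<psi> s) (\<psi> t)) Z =
        (\<Sum>i<?n. (\<Sum>j<?n. Z $$ (i, j) * \<psi> t $ j) * cnj (\<psi> s $ i))"
      using G \<open>Z \<in> ?G\<close>
      by (simp only: hs_inner_ket_bra[OF carrier carrier] subsetD sum_distrib_left sum_distrib_right mult_ac)
    also have "\<dots> = Z $$ (s, t) + Z $$ (s, ?p + t + 1) +
        (Z $$ (?p + s + 1, t) + Z $$ (?p + s + 1, ?p + t + 1))"
      using st by (simp only: row col)
    \<comment> \<open>The two mixed terms lie in off-diagonal blocks and vanish; the others come
      from blocks 0 and 1.\<close>
    also have "\<dots> = c * Y $$ (s, t) + c * Y $$ (s + 1, t + 1)"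
    proof -
      have quot: "s div ?p = 0" "(?p + s + 1) div ?p = 1" "s mod ?p = s" "(?p + s + 1) mod ?p = s + 1"
        if "s < m" for s
      proof -
        show "(?p + s + 1) div ?p = 1"
          using that by (intro div_nat_eqI) auto
        show "(?p + s + 1) mod ?p = s + 1"
          using that by (subst le_mod_geq) auto
      qed (use that in auto)
      have less: "s < 2 * ?p" "?p + s + 1 < 2 * ?p" if "s < m" for s
        using that by auto
      show ?thesis
        using st by (simp only: Z kronecker_scalar_index[OF Yc] less quot) simp
    qed
    \<comment> \<open>Alternation cancels the two terms; it is available because
      \<open>s \<noteq> t\<close>.\<close>
    also have "\<dots> = 0"
      using Y st by (simp add: alternating_graph_def)
    finally show "hs_inner (ket_bra (\<psi> s) (\<psi> t)) Z = 0" .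
  qed
  then show "independent_vecs ?n (graph_tensor 2 ?p (scalar_graph 2) ?T) m \<psi>"
    unfolding independent_vecs_def graph_tensor_def
    using carrier nonzero hs_orthogonal_span[OF carrier carrier G] by blast
qed

theorem theorem12:
  fixes m :: nat
  assumes "m \<ge> 3"
  shows "\<exists>T :: complex mat set.
    noncommutative_graph (m + 1) T \<and>
    zero_error_capacity (m + 1) T = 0 \<and>
    zero_error_capacity (2 * (m + 1)) (graph_tensor 2 (m + 1) (scalar_graph 2) T) \<ge> log 2 (real m) \<and>
    log 2 (real m) > 1 \<and>
    1 = zero_error_capacity 2 (scalar_graph 2) + zero_error_capacity (m + 1) T"
proof (intro exI[of _ "alternating_graph m"] conjI)
  show "noncommutative_graph (m + 1) (alternating_graph m)"
    by (rule noncommutative_graph_alternating)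
  show zero: "zero_error_capacity (m + 1) (alternating_graph m) = 0"
    unfolding zero_error_capacity_def independence_number_alternating by simp
  show "log 2 (real m) \<le> zero_error_capacity (2 * (m + 1))
      (graph_tensor 2 (m + 1) (scalar_graph 2) (alternating_graph m))"
    unfolding zero_error_capacity_def
    using independence_number_tensor_alternating[of m] assms by simp
  show "log 2 (real m) > 1"
    using assms by simp
  show "1 = zero_error_capacity 2 (scalar_graph 2) + zero_error_capacity (m + 1) (alternating_graph m)"
    unfolding zero by (simp add: zero_error_capacity_def independence_number_scalar_graph)
qed

end
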